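(* Let $G=K_{n_1,\ldots,n_k}$ and suppose $G$ has an equitable $q$-coloring. Then $p(q:n_1,\ldots,n_k)$ is the minimum $p$ such that $G$ has an equitable $r$-coloring for each integer $r$ with $p\le r\le q$. In particular, the equitable chromatic threshold of $K_{n_1,\ldots,n_k}$ equals $p(n_1+\cdots+n_k:n_1,\ldots,n_k)$.
   Context: All graphs are finite and simple. For a graph $G$ with $N=|V(G)|$ vertices, an equitable $q$-coloring of $G$ is a partition of $V(G)$ into $q$ (possibly empty) independent sets, each of size $\lfloor N/q\rfloor$ or $\lceil N/q\rceil$. The equitable chromatic threshold of $G$ is the minimum $p$ such that $G$ has an equitable $q$-coloring for every integer $q\ge p$. $K_{n_1,\ldots,n_k}$ is the complete $k$-partite graph with partite sets $X_1,\ldots,X_k$, $|X_i|=n_i$. Definition of $p$: suppose $K_{n_1,\ldots,n_k}$ has an equitable $q$-coloring. Then $p(q:n_1,\ldots,n_k)=\lceil n_1/d\rceil+\cdots+\lceil n_k/d\rceil$, where $d$ is the minimum integer with $d\ge\lceil (n_1+\cdots+n_k)/q\rceil$ satisfying at least one of: (i) there exist $i\ne j$ such that neither $n_i$ nor $n_j$ is divisible by $d$; (ii) there exists $i$ with $n_i/\lfloor n_i/d\rfloor>d+1$.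
   Formalization: Assumes k ≥ 2 and all n_i ≥ 1 (for k = 1 the claim fails: n_1 = 5, q = 5 gives p = 2, but a 1-coloring exists), and in (ii) the quotient n_i/⌊n_i/d⌋ is read as infinite, so (ii) holds, when ⌊n_i/d⌋ = 0. *)

theory Defs
  imports Complex_Main "HOL-Library.Disjoint_Sets" "Graph_Theory.Digraph"
begin

text \<open>
  Finite simple graphs are the symmetric, loop-free, finite digraphs without multiple arcs of the
  locale \<^locale>\<open>graph\<close>; the edge between u and v is the pair of arcs with ends (u, v) and (v, u).
  As for the complete graphs of the Graph-Theory library, being a complete multipartite graph
  is a predicate, so that statements cover every graph in the isomorphism class. The sizes
  \<open>n\<^sub>1, \<dots>, n\<^sub>k\<close> form a list, indexed from 0.
\<close>

definition complete_multipartite_graph :: "nat list \<Rightarrow> ('a, 'b) pre_digraph \<Rightarrow> bool" where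
  "complete_multipartite_graph ns G \<longleftrightarrow> graph G \<and>
    (\<exists>X :: nat \<Rightarrow> 'a set.
      (\<forall>i < length ns. card (X i) = ns ! i) \<and>
      disjoint_family_on X {..<length ns} \<and>
      verts G = (\<Union>i < length ns. X i) \<and>
      arcs_ends G = {(u, v). \<exists>i < length ns. \<exists>j < length ns. i \<noteq> j \<and> u \<in> X i \<and> v \<in> X j})"

definition independent_vertices :: "('a, 'b) pre_digraph \<Rightarrow> 'a set \<Rightarrow> bool" where
  "independent_vertices G S \<longleftrightarrow> S \<subseteq> verts G \<and> (\<forall>u \<in> S. \<forall>v \<in> S. (u, v) \<notin> arcs_ends G)"

text \<open>
  The classes are an indexed family because several of them may be empty.
  For \<open>q = 0\<close> there are no classes, so only the graph without vertices is colorable.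
\<close>

definition equitably_colorable :: "('a, 'b) pre_digraph \<Rightarrow> nat \<Rightarrow> bool" where
  "equitably_colorable G q \<longleftrightarrow>
    (\<exists>C :: nat \<Rightarrow> 'a set.
      disjoint_family_on C {..<q} \<and>
      (\<Union>c < q. C c) = verts G \<and>
      (\<forall>c < q. independent_vertices G (C c) \<and>
        int (card (C c)) \<in> {\<lfloor>real (card (verts G)) / real q\<rfloor>, \<lceil>real (card (verts G)) / real q\<rceil>}))"

definition equitable_chromatic_threshold :: "('a, 'b) pre_digraph \<Rightarrow> nat" where
  "equitable_chromatic_threshold G = (LEAST p. \<forall>q \<ge> p. equitably_colorable G q)"

text \<open>
  In the second alternative \<open>n\<^sub>i / \<lfloor>n\<^sub>i / d\<rfloor>\<close> is infinite if \<open>d > n\<^sub>i\<close>, hence exceeds \<open>d + 1\<close>;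
  this case is spelled out because \<open>x / 0 = 0\<close> in HOL.
\<close>

definition obstructing :: "nat list \<Rightarrow> nat \<Rightarrow> bool" where
  "obstructing ns d \<longleftrightarrow>
    (\<exists>i < length ns. \<exists>j < length ns. i \<noteq> j \<and> \<not> d dvd ns ! i \<and> \<not> d dvd ns ! j) \<or>
    (\<exists>i < length ns. \<lfloor>real (ns ! i) / real d\<rfloor> = 0 \<or>
       real (ns ! i) / real_of_int \<lfloor>real (ns ! i) / real d\<rfloor> > real d + 1)"

definition obstruction_size :: "nat \<Rightarrow> nat list \<Rightarrow> nat" where
  "obstruction_size q ns =
    (LEAST d. int d \<ge> \<lceil>real (sum_list ns) / real q\<rceil> \<and> obstructing ns d)"

definition p_value :: "nat \<Rightarrow> nat list \<Rightarrow> nat" where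
  "p_value q ns =
    (\<Sum>i < length ns. nat \<lceil>real (ns ! i) / real (obstruction_size q ns)\<rceil>)"

lemma obstruction_size_exists:
  assumes "ns \<noteq> []"
  shows "\<exists>d. int d \<ge> \<lceil>real (sum_list ns) / real q\<rceil> \<and> obstructing ns d"
proof -
  define d where "d = nat \<lceil>real (sum_list ns) / real q\<rceil> + ns ! 0 + 1"
  have "ns ! 0 < d"
    by (simp add: d_def)
  then have "real (ns ! 0) / real d < 1" "0 \<le> real (ns ! 0) / real d"
    by (simp_all add: divide_less_eq)
  then have "\<lfloor>real (ns ! 0) / real d\<rfloor> = 0"
    by linarith
  then have "obstructing ns d"
    using assms unfolding obstructing_def by blast
  moreover have "int d \<ge> \<lceil>real (sum_list ns) / real q\<rceil>"
    unfolding d_def by linarith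
  ultimately show ?thesis by blast
qed

end

theory Submission
  imports Defs
begin

text \<open>
  An independent set of a complete multipartite graph lies in one part, so an equitable
  \<open>r\<close>-coloring amounts to a number \<open>s\<close> and a splitting of each \<open>n\<^sub>i\<close> into \<open>a\<^sub>i\<close> summands
  \<open>s\<close> or \<open>s + 1\<close> with \<open>\<Sum> a\<^sub>i = r\<close>. For fixed \<open>s > 0\<close>, provided that
  \<open>\<lceil>n\<^sub>i / (s + 1)\<rceil> \<le> \<lfloor>n\<^sub>i / s\<rfloor>\<close> for all \<open>i\<close>, the possible \<open>r\<close> form the interval from
  \<open>\<Sum> \<lceil>n\<^sub>i / (s + 1)\<rceil>\<close> to \<open>\<Sum> \<lfloor>n\<^sub>i / s\<rfloor>\<close>. A size \<open>s\<close> is not obstructing precisely if this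
  proviso holds and the interval for \<open>s\<close> reaches up to \<open>\<Sum> \<lceil>n\<^sub>i / s\<rceil> - 1\<close>; hence the intervals
  of the sizes below the obstruction size \<open>d\<close> leave no gap above \<open>p = \<Sum> \<lceil>n\<^sub>i / d\<rceil>\<close>, whereas
  \<open>p - 1\<close> lies in no interval. For sizes \<open>s > d\<close> the last claim needs two parts: if only one
  \<open>n\<^sub>i\<close> is not divisible by \<open>d\<close>, then \<open>\<lfloor>n\<^sub>j / s\<rfloor> < n\<^sub>j / d\<close> for any other \<open>n\<^sub>j\<close>.
\<close>

text \<open>The two inequalities hold exactly if \<open>ns ! i\<close> is a sum of
  \<open>a i\<close> numbers from \<open>{s, Suc s}\<close>. As products they also cover
  \<open>s = 0\<close>, where classes may be empty.\<close>

definition splittable :: "nat list \<Rightarrow> nat \<Rightarrow> nat \<Rightarrow> bool" where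
  "splittable ns s r \<longleftrightarrow>
    (\<exists>a. (\<forall>i < length ns. a i * s \<le> ns ! i \<and> ns ! i \<le> a i * Suc s) \<and> (\<Sum>i < length ns. a i) = r)"

definition ceil_sum :: "nat list \<Rightarrow> nat \<Rightarrow> nat" where
  "ceil_sum ns d = (\<Sum>i < length ns. nat \<lceil>real (ns ! i) / real d\<rceil>)"

definition floor_sum :: "nat list \<Rightarrow> nat \<Rightarrow> nat" where
  "floor_sum ns d = (\<Sum>i < length ns. ns ! i div d)"

section \<open>Arithmetic of rounded quotients\<close>

lemma nat_ceiling_divide_le_iff:
  assumes "d > 0"
  shows "nat \<lceil>real n / real d\<rceil> \<le> a \<longleftrightarrow> n \<le> a * d"
proof -
  have "nat \<lceil>real n / real d\<rceil> \<le> a \<longleftrightarrow> real n / real d \<le> real a"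
    by (simp add: nat_le_iff ceiling_le_iff)
  also have "\<dots> \<longleftrightarrow> real n \<le> real (a * d)"
    using assms by (simp add: divide_le_eq)
  finally show ?thesis
    by (simp only: of_nat_le_iff)
qed

lemma le_nat_ceiling_divide_mult:
  assumes "d > 0"
  shows "n \<le> nat \<lceil>real n / real d\<rceil> * d"
  using nat_ceiling_divide_le_iff[OF assms] by blast

lemma nat_ceiling_divide_antimono:
  assumes "d > 0" "d \<le> e"
  shows "nat \<lceil>real n / real e\<rceil> \<le> nat \<lceil>real n / real d\<rceil>"
  using le_nat_ceiling_divide_mult[OF assms(1), of n] assms
  by (subst nat_ceiling_divide_le_iff) (auto intro: order_trans mult_le_mono2)

lemma nat_ceiling_divide_eq_div:
  assumes "d > 0"
  shows "nat \<lceil>real n / real d\<rceil> = n div d + (if d dvd n then 0 else 1)"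
proof (cases "d dvd n")
  case True
  then show ?thesis using assms by (auto elim!: dvdE)
next
  case False
  have "nat \<lceil>real n / real d\<rceil> \<le> n div d + 1"
    using assms by (subst nat_ceiling_divide_le_iff) (auto intro: less_imp_le dividend_less_div_times)
  moreover have "\<not> nat \<lceil>real n / real d\<rceil> \<le> n div d"
    using assms False div_mult_mod_eq[of n d] by (subst nat_ceiling_divide_le_iff)
      (auto simp only: dvd_eq_mod_eq_0)
  ultimately have "nat \<lceil>real n / real d\<rceil> = n div d + 1" by linarith
  then show ?thesis using False by simp
qed

lemma ceil_sum_antimono:
  assumes "d > 0" "d \<le> e"
  shows "ceil_sum ns e \<le> ceil_sum ns d"
  unfolding ceil_sum_def by (intro sum_mono nat_ceiling_divide_antimono assms)

text \<open>Every entry not divisible by \<open>d\<close> contributes 1 to the difference, so the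
  first alternative of \<open>obstructing\<close> means a difference of at least 2.\<close>

lemma ceil_sum_eq_floor_sum:
  assumes "d > 0"
  shows "ceil_sum ns d = floor_sum ns d + card {i. i < length ns \<and> \<not> d dvd ns ! i}"
proof -
  have "(\<Sum>i < length ns. if d dvd ns ! i then 0 else 1)
      = (\<Sum>i | i < length ns \<and> \<not> d dvd ns ! i. 1::nat)"
    by (intro sum.mono_neutral_cong_right) auto
  then show ?thesis
    by (simp add: ceil_sum_def floor_sum_def nat_ceiling_divide_eq_div[OF assms] sum.distrib)
qed

text \<open>Clearing denominators removes the reals. If the second alternative fails, then
  \<open>ns ! i \<le> ns ! i div d * Suc d\<close>, so the ceiling for \<open>Suc d\<close> is at
  most the floor for \<open>d\<close>.\<close>

lemma obstructing_iff:
  assumes "d > 0"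
  shows "obstructing ns d \<longleftrightarrow>
    (\<exists>i < length ns. \<exists>j < length ns. i \<noteq> j \<and> \<not> d dvd ns ! i \<and> \<not> d dvd ns ! j) \<or>
    (\<exists>i < length ns. ns ! i div d = 0 \<or> ns ! i > ns ! i div d * Suc d)"
proof -
  have "real n / real (n div d) > real d + 1 \<longleftrightarrow> n > n div d * Suc d" if "n div d \<noteq> 0" for n
  proof -
    have "real n / real (n div d) > real d + 1 \<longleftrightarrow> real n > (real d + 1) * real (n div d)"
      using that by (subst less_divide_eq) auto
    also have "(real d + 1) * real (n div d) = real (n div d * Suc d)"
      by (simp add: algebra_simps)
    finally show ?thesis by (simp only: of_nat_less_iff)
  qed
  then show ?thesis
    unfolding obstructing_def floor_divide_of_nat_eq of_int_of_nat_eq of_nat_eq_0_iff by blast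
qed

section \<open>Splittings for a fixed class size\<close>

lemma sum_intermediate_value:
  fixes lo hi :: "'i \<Rightarrow> nat"
  assumes "finite I" "\<And>i. i \<in> I \<Longrightarrow> lo i \<le> hi i" "sum lo I \<le> r" "r \<le> sum hi I"
  shows "\<exists>a. (\<forall>i\<in>I. lo i \<le> a i \<and> a i \<le> hi i) \<and> sum a I = r"
  using assms
proof (induction I arbitrary: r rule: finite_induct)
  case empty
  then show ?case by simp
next
  case (insert x I)
  \<comment> \<open>The largest value for \<open>x\<close> that leaves the lower bounds
    \<open>sum lo I\<close> to the other indices; if \<open>hi x\<close> caps it, the remainder is
    still at most \<open>sum hi I\<close>.\<close>
  define t where "t = min (hi x) (r - sum lo I)"
  have le: "sum lo I \<le> sum hi I" using insert.prems by (intro sum_mono) auto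
  have t: "lo x \<le> t" "t \<le> hi x" "sum lo I \<le> r - t" "r - t \<le> sum hi I" "t \<le> r"
    using insert.prems insert.hyps le by (auto simp: t_def min_def)
  obtain a where a: "\<forall>i\<in>I. lo i \<le> a i \<and> a i \<le> hi i" "sum a I = r - t"
    using insert.IH[OF _ t(3,4)] insert.prems(1) by auto
  have "sum (a(x := t)) I = sum a I" using insert.hyps by (intro sum.cong) auto
  then show ?case using a t insert.hyps by (intro exI[of _ "a(x := t)"]) auto
qed

lemma ceil_sum_le_of_splittable:
  assumes "splittable ns s r"
  shows "ceil_sum ns (Suc s) \<le> r"
proof -
  obtain a where a: "\<And>i. i < length ns \<Longrightarrow> ns ! i \<le> a i * Suc s"
    and r: "(\<Sum>i < length ns. a i) = r"
    using assms unfolding splittable_def by blast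
  show ?thesis
    unfolding ceil_sum_def r[symmetric] using a
    by (intro sum_mono) (subst nat_ceiling_divide_le_iff, auto)
qed

lemma splittable_imp:
  assumes "splittable ns s r" "s > 0"
  shows "\<forall>i < length ns. ns ! i \<le> ns ! i div s * Suc s"
    and "r \<le> floor_sum ns s"
proof -
  obtain a where a: "\<And>i. i < length ns \<Longrightarrow> a i * s \<le> ns ! i"
      "\<And>i. i < length ns \<Longrightarrow> ns ! i \<le> a i * Suc s" and r: "(\<Sum>i < length ns. a i) = r"
    using assms(1) unfolding splittable_def by blast
  have hi: "a i \<le> ns ! i div s" if "i < length ns" for i
    using a(1)[OF that] assms(2) by (simp add: less_eq_div_iff_mult_less_eq)
  show "\<forall>i < length ns. ns ! i \<le> ns ! i div s * Suc s"
    using a(2) hi by (blast intro: order_trans mult_le_mono1)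
  show "r \<le> floor_sum ns s"
    unfolding floor_sum_def r[symmetric] using hi by (intro sum_mono) auto
qed

text \<open>Each ceiling is at most the corresponding floor, so the \<open>a i\<close> vary
  independently between them and every sum in the interval is attained.\<close>

lemma splittableI:
  assumes "s > 0" "\<And>i. i < length ns \<Longrightarrow> ns ! i \<le> ns ! i div s * Suc s"
    and "ceil_sum ns (Suc s) \<le> r" "r \<le> floor_sum ns s"
  shows "splittable ns s r"
proof -
  obtain a where a: "\<forall>i\<in>{..<length ns}. nat \<lceil>real (ns ! i) / real (Suc s)\<rceil> \<le> a i \<and> a i \<le> ns ! i div s"
    and r: "sum a {..<length ns} = r"
    using sum_intermediate_value[of "{..<length ns}" "\<lambda>i. nat \<lceil>real (ns ! i) / real (Suc s)\<rceil>"
        "\<lambda>i. ns ! i div s" r] assms nat_ceiling_divide_le_iff[of "Suc s"]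
    unfolding ceil_sum_def floor_sum_def by auto
  have "a i * s \<le> ns ! i \<and> ns ! i \<le> a i * Suc s" if "i < length ns" for i
    using a that assms(1) nat_ceiling_divide_le_iff[of "Suc s" "ns ! i" "a i"]
    by (auto simp: less_eq_div_iff_mult_less_eq)
  then show ?thesis unfolding splittable_def using r by blast
qed

lemma sum_list_le_of_splittable:
  assumes "splittable ns s r"
  shows "sum_list ns \<le> r * Suc s"
proof -
  obtain a where a: "\<And>i. i < length ns \<Longrightarrow> ns ! i \<le> a i * Suc s"
    and r: "(\<Sum>i < length ns. a i) = r"
    using assms unfolding splittable_def by blast
  show ?thesis
    unfolding r[symmetric] sum_list_sum_nth sum_distrib_right atLeast0LessThan
    using a by (intro sum_mono) simp
qed

section \<open>Splittings on both sides of the obstruction size\<close>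

text \<open>At most one entry is not divisible by \<open>s\<close>, so the floors sum to at least
  \<open>ceil_sum ns s - 1\<close>, hence to at least \<open>r\<close>.\<close>

lemma non_obstructing_interval:
  assumes "s > 0" "\<not> obstructing ns s" "ceil_sum ns (Suc s) \<le> r" "r < ceil_sum ns s"
  shows "splittable ns s r"
proof (rule splittableI)
  have "\<not> (\<exists>i < length ns. \<exists>j < length ns. i \<noteq> j \<and> \<not> s dvd ns ! i \<and> \<not> s dvd ns ! j)"
    using assms(1,2) obstructing_iff by blast
  then have "card {i. i < length ns \<and> \<not> s dvd ns ! i} \<le> 1"
    by (subst One_nat_def, subst card_le_Suc0_iff_eq) auto
  then show "r \<le> floor_sum ns s"
    using ceil_sum_eq_floor_sum[OF assms(1), of ns] assms(4) by linarith
  show "ns ! i \<le> ns ! i div s * Suc s" if "i < length ns" for i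
    using assms(1,2) that unfolding obstructing_iff[OF assms(1)] by (meson not_less)
qed (use assms in auto)

text \<open>The half-open ranges from \<open>ceil_sum ns (Suc s)\<close> to
  \<open>ceil_sum ns s\<close> abut for consecutive \<open>s\<close>; the induction on
  \<open>d\<close> adds them one at a time.\<close>

lemma non_obstructing_cover:
  assumes "d\<^sub>0 > 0" "d\<^sub>0 \<le> d" "\<And>s. d\<^sub>0 \<le> s \<Longrightarrow> s < d \<Longrightarrow> \<not> obstructing ns s"
    and "ceil_sum ns d \<le> r" "r < ceil_sum ns d\<^sub>0"
  shows "\<exists>s. splittable ns s r"
  using assms(2-)
proof (induction d rule: dec_induct)
  case base
  then show ?case by simp
next
  case (step d)
  show ?case
  proof (cases "ceil_sum ns d \<le> r")
    case True
    then show ?thesis using step by simp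
  next
    case False
    then show ?thesis using non_obstructing_interval[of d ns r] step assms(1) by auto
  qed
qed

lemma not_splittable_below_obstruction:
  assumes len: "length ns \<ge> 2" and pos: "\<forall>i < length ns. ns ! i \<ge> 1"
    and d: "d > 0" "obstructing ns d" and r: "Suc r = ceil_sum ns d"
  shows "\<not> splittable ns s r"
proof
  assume spl: "splittable ns s r"
  have ds: "d \<le> s"
  proof (rule ccontr)
    assume "\<not> d \<le> s"
    then have "ceil_sum ns d \<le> ceil_sum ns (Suc s)" by (intro ceil_sum_antimono) auto
    then show False using ceil_sum_le_of_splittable[OF spl] r by simp
  qed
  define B where "B = {i. i < length ns \<and> \<not> d dvd ns ! i}"
  have "finite B" unfolding B_def by simp
  note s = splittable_imp[OF spl less_le_trans[OF d(1) ds]]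
  have mono: "ns ! i div s \<le> ns ! i div d" for i
    using ds d(1) by (intro div_le_mono2) auto
  then have fl: "floor_sum ns s \<le> floor_sum ns d"
    unfolding floor_sum_def by (intro sum_mono)
  \<comment> \<open>Since \<open>r\<close> is \<open>ceil_sum ns d - 1\<close> and at most
    \<open>floor_sum ns d\<close>, the first alternative of \<open>obstructing\<close> fails and the
    second supplies an entry \<open>i\<close>.\<close>
  have "card B \<le> 1"
    using fl s(2) r ceil_sum_eq_floor_sum[OF d(1), of ns] unfolding B_def by linarith
  then have B: "i = j" if "i \<in> B" "j \<in> B" for i j
    using that card_le_Suc0_iff_eq[OF \<open>finite B\<close>] by auto
  then obtain i where i: "i < length ns" "ns ! i div d = 0 \<or> ns ! i > ns ! i div d * Suc d"
    using d unfolding obstructing_iff[OF d(1)] B_def by blast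
  \<comment> \<open>A positive multiple of \<open>d\<close> satisfies neither disjunct.\<close>
  have iB: "i \<in> B"
    using i pos[rule_format, OF i(1)] unfolding B_def by (auto elim!: dvdE)
  have "s \<noteq> d"
    using s(1) i pos[rule_format, OF i(1)] by fastforce
  then have "d < s" using ds by simp
  \<comment> \<open>Some index other than \<open>i\<close>. Its entry is a positive multiple of
    \<open>d\<close>, so the larger size \<open>s\<close> strictly lowers its quotient, and
    \<open>floor_sum ns s\<close> drops below \<open>floor_sum ns d = r\<close>.\<close>
  define j where "j = (if i = 0 then 1 else 0 :: nat)"
  have j: "j < length ns" "j \<noteq> i" using len by (auto simp: j_def)
  then have "d dvd ns ! j" using B[OF iB, of j] unfolding B_def by auto
  then have "ns ! j div s < ns ! j div d"
    using pos[rule_format, OF j(1)] \<open>d < s\<close> d(1) by (auto elim!: dvdE simp: div_less_iff_less_mult)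
  then have "floor_sum ns s < floor_sum ns d"
    unfolding floor_sum_def using mono j(1) by (intro sum_strict_mono_ex1) auto
  moreover have "card B > 0" using iB \<open>finite B\<close> card_gt_0_iff by blast
  moreover have "card B = 1" using calculation(2) \<open>card B \<le> 1\<close> by simp
  ultimately show False
    using s(2) r ceil_sum_eq_floor_sum[OF d(1), of ns] unfolding B_def by linarith
qed

section \<open>Colorings versus splittings\<close>

lemma equitable_partition_exists:
  assumes "finite X" "a * s \<le> card X" "card X \<le> a * Suc s"
  shows "\<exists>D. disjoint_family_on D {..<a} \<and> (\<Union>c<a. D c) = X \<and> (\<forall>c<a. card (D c) \<in> {s, Suc s})"
  using assms
proof (induction a arbitrary: X)
  case 0
  then show ?case by (simp add: disjoint_family_on_def)
next
  case (Suc a)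
  \<comment> \<open>The larger size is taken whenever \<open>a\<close> classes of size at least
    \<open>s\<close> can still be filled; otherwise \<open>card X\<close> is exactly
    \<open>Suc a * s\<close>.\<close>
  define t where "t = (if a * s + Suc s \<le> card X then Suc s else s)"
  have t: "t \<in> {s, Suc s}" "t \<le> card X" "a * s \<le> card X - t" "card X - t \<le> a * Suc s"
    using Suc.prems by (auto simp: t_def)
  obtain T where T: "T \<subseteq> X" "card T = t" using t(2) by (meson obtain_subset_with_card_n)
  have "card (X - T) = card X - t" using T Suc.prems(1) by (simp add: card_Diff_subset finite_subset)
  then obtain D where D: "disjoint_family_on D {..<a}" "(\<Union>c<a. D c) = X - T"
      "\<forall>c<a. card (D c) \<in> {s, Suc s}"
    using Suc.IH[of "X - T"] Suc.prems(1) t by auto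
  have "D c \<inter> T = {}" if "c < a" for c using D(2) that by blast
  then have "disjoint_family_on (D(a := T)) {..<Suc a}"
    using D(1) unfolding disjoint_family_on_def by (auto simp: less_Suc_eq; blast)
  moreover have "(\<Union>c<Suc a. (D(a := T)) c) = X"
    using D(2) T(1) by (auto simp: lessThan_Suc)
  moreover have "\<forall>c<Suc a. card ((D(a := T)) c) \<in> {s, Suc s}"
    using D(3) T(2) t(1) by (auto simp: less_Suc_eq)
  ultimately show ?case by blast
qed

text \<open>The witness counts the classes assigned to each part; an empty class is assigned to an
  arbitrary part, which exists as \<open>ns\<close> is nonempty.\<close>

lemma splittable_of_equitably_colorable:
  assumes G: "complete_multipartite_graph ns G" and ne: "ns \<noteq> []" and col: "equitably_colorable G q"
  shows "splittable ns (sum_list ns div q) q" and "card (verts G) = sum_list ns"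
proof -
  obtain X where X: "\<And>i. i < length ns \<Longrightarrow> card (X i) = ns ! i"
      "disjoint_family_on X {..<length ns}" "verts G = (\<Union>i < length ns. X i)"
      "arcs_ends G = {(u, v). \<exists>i < length ns. \<exists>j < length ns. i \<noteq> j \<and> u \<in> X i \<and> v \<in> X j}"
    and "graph G"
    using G unfolding complete_multipartite_graph_def by blast
  then interpret graph G by simp
  have finX: "finite (X i)" if "i < length ns" for i
    using finite_verts X(3) that by (auto intro: finite_subset)
  show card: "card (verts G) = sum_list ns"
    unfolding X(3) sum_list_sum_nth atLeast0LessThan
    using X(1,2) finX by (subst card_UN_disjoint) (auto simp: disjoint_family_on_def)
  obtain C where C: "disjoint_family_on C {..<q}" "(\<Union>c < q. C c) = verts G"
      "\<And>c. c < q \<Longrightarrow> independent_vertices G (C c)"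
      "\<And>c. c < q \<Longrightarrow> int (card (C c)) \<in> {\<lfloor>real (card (verts G)) / real q\<rfloor>, \<lceil>real (card (verts G)) / real q\<rceil>}"
    using col unfolding equitably_colorable_def by blast
  define s where "s = sum_list ns div q"
  have s: "s \<le> card (C c) \<and> card (C c) \<le> Suc s" if "c < q" for c
  proof -
    have "\<lfloor>real (card (verts G)) / real q\<rfloor> = int s"
      by (simp add: floor_divide_of_nat_eq card s_def)
    then show ?thesis using C(4)[OF that] by auto linarith+
  qed
  have finC: "finite (C c)" if "c < q" for c
    using C(2) finite_verts that by (blast intro: finite_subset)
  have "\<exists>i < length ns. C c \<subseteq> X i" if c: "c < q" for c
  proof (cases "C c = {}")
    case True
    then show ?thesis using ne by auto
  next
    case False
    then obtain u where u: "u \<in> C c" by blast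
    then obtain i where i: "i < length ns" "u \<in> X i" using C(2) X(3) c by blast
    have "v \<in> X i" if "v \<in> C c" for v
    proof -
      obtain j where j: "j < length ns" "v \<in> X j" using C(2) X(3) c \<open>v \<in> C c\<close> by blast
      have "(u, v) \<notin> arcs_ends G"
        using C(3)[OF c] u \<open>v \<in> C c\<close> unfolding independent_vertices_def by blast
      then show ?thesis using X(4) i j by blast
    qed
    then show ?thesis using i by blast
  qed
  then obtain part where part: "\<And>c. c < q \<Longrightarrow> part c < length ns" "\<And>c. c < q \<Longrightarrow> C c \<subseteq> X (part c)"
    by metis
  define F where "F i = {c \<in> {..<q}. part c = i}" for i
  have "card (F i) * s \<le> ns ! i \<and> ns ! i \<le> card (F i) * Suc s" if i: "i < length ns" for i
  proof -
    have "X i \<subseteq> (\<Union>c \<in> F i. C c)"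
    proof
      fix v assume v: "v \<in> X i"
      then obtain c where c: "c < q" "v \<in> C c" using X(3) C(2) i by blast
      then have "part c = i"
        using X(2) part[OF c(1)] v i unfolding disjoint_family_on_def by blast
      then show "v \<in> (\<Union>c \<in> F i. C c)" using c unfolding F_def by blast
    qed
    then have "X i = (\<Union>c \<in> F i. C c)" using part(2) unfolding F_def by blast
    then have "ns ! i = card (\<Union>c \<in> F i. C c)" using X(1)[OF i] by simp
    also have "\<dots> = (\<Sum>c \<in> F i. card (C c))"
      using C(1) finC by (intro card_UN_disjoint) (auto simp: F_def disjoint_family_on_def)
    finally have "ns ! i = (\<Sum>c \<in> F i. card (C c))" .
    moreover have "(\<Sum>c \<in> F i. s) \<le> (\<Sum>c \<in> F i. card (C c))" "(\<Sum>c \<in> F i. card (C c)) \<le> (\<Sum>c \<in> F i. Suc s)"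
      by (rule sum_mono, use s in \<open>simp add: F_def\<close>)+
    ultimately show ?thesis by simp
  qed
  moreover have "(\<Sum>i < length ns. card (F i)) = q"
    using sum.group[of "{..<q}" "{..<length ns}" part "\<lambda>_. 1::nat"] part(1)
    by (simp add: F_def image_subset_iff)
  ultimately show "splittable ns (sum_list ns div q) q"
    unfolding splittable_def s_def[symmetric] by (intro exI[of _ "\<lambda>i. card (F i)"]) simp
qed

text \<open>The floor of the mean need not be \<open>s\<close>, since all sizes may be
  \<open>Suc s\<close>. But one class of size \<open>s\<close> forces a mean below
  \<open>Suc s\<close>, hence floor \<open>s\<close>, and one of size \<open>Suc s\<close> forces a
  mean above \<open>s\<close>, hence ceiling \<open>Suc s\<close>.\<close>

lemma equitable_sizes:
  fixes m :: "nat \<Rightarrow> nat"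
  assumes "\<And>c. c < r \<Longrightarrow> m c \<in> {s, Suc s}" "c < r"
  shows "int (m c) \<in> {\<lfloor>real (\<Sum>c<r. m c) / real r\<rfloor>, \<lceil>real (\<Sum>c<r. m c) / real r\<rceil>}"
proof -
  define N where "N = (\<Sum>c<r. m c)"
  have le: "s * r \<le> N" "N \<le> Suc s * r"
    using sum_mono[of "{..<r}" "\<lambda>_. s" m] sum_mono[of "{..<r}" m "\<lambda>_. Suc s"] assms(1)
    by (fastforce simp: N_def mult.commute)+
  have r: "real r > 0" using assms(2) by simp
  consider "m c = s" | "m c = Suc s" using assms by blast
  then show ?thesis
  proof cases
    case 1
    have "N < (\<Sum>c<r. Suc s)"
      unfolding N_def using assms 1 by (intro sum_strict_mono_ex1) (force intro: bexI[of _ c])+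
    then have "N div r = s" using le(1) assms(2)
      by (intro div_nat_eqI) (simp_all add: mult.commute)
    then have "\<lfloor>real N / real r\<rfloor> = int s" by (simp add: floor_divide_of_nat_eq)
    then show ?thesis using 1 unfolding N_def by simp
  next
    case 2
    have "(\<Sum>c<r. s) < N"
      unfolding N_def using assms 2 by (intro sum_strict_mono_ex1) (force intro: bexI[of _ c])+
    then have "real (s * r) < real N" unfolding of_nat_less_iff by (simp add: mult.commute)
    moreover have "real N \<le> real (Suc s * r)" using le(2) by (simp only: of_nat_le_iff)
    ultimately have "\<lceil>real N / real r\<rceil> = int (Suc s)"
      using r by (intro ceiling_unique) (simp_all add: field_simps)
    then show ?thesis using 2 unfolding N_def by simp
  qed
qed

text \<open>Each part is cut separately. Any \<open>s\<close> will do, because sizes from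
  \<open>{s, Suc s}\<close> are the floor or the ceiling of their mean.\<close>

lemma equitably_colorable_of_splittable:
  assumes G: "complete_multipartite_graph ns G" and spl: "splittable ns s r"
  shows "equitably_colorable G r"
proof -
  obtain X where X: "\<And>i. i < length ns \<Longrightarrow> card (X i) = ns ! i"
      "disjoint_family_on X {..<length ns}" "verts G = (\<Union>i < length ns. X i)"
      "arcs_ends G = {(u, v). \<exists>i < length ns. \<exists>j < length ns. i \<noteq> j \<and> u \<in> X i \<and> v \<in> X j}"
    and "graph G"
    using G unfolding complete_multipartite_graph_def by blast
  then interpret graph G by simp
  have finX: "finite (X i)" if "i < length ns" for i
    using finite_verts X(3) that by (auto intro: finite_subset)
  obtain a where a: "\<forall>i < length ns. a i * s \<le> ns ! i \<and> ns ! i \<le> a i * Suc s"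
    and r: "(\<Sum>i < length ns. a i) = r"
    using spl unfolding splittable_def by blast
  have "\<forall>i \<in> {..<length ns}. \<exists>D. disjoint_family_on D {..<a i} \<and> (\<Union>c<a i. D c) = X i \<and>
      (\<forall>c<a i. card (D c) \<in> {s, Suc s})"
    using a X(1) finX by (intro ballI equitable_partition_exists) simp_all
  from bchoice[OF this] obtain D where "\<forall>i \<in> {..<length ns}. disjoint_family_on (D i) {..<a i} \<and>
      (\<Union>c<a i. D i c) = X i \<and> (\<forall>c<a i. card (D i c) \<in> {s, Suc s})"
    by blast
  then have D: "\<And>i. i < length ns \<Longrightarrow> disjoint_family_on (D i) {..<a i}"
      "\<And>i. i < length ns \<Longrightarrow> (\<Union>c<a i. D i c) = X i"
      "\<And>i c. i < length ns \<Longrightarrow> c < a i \<Longrightarrow> card (D i c) \<in> {s, Suc s}"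
    by (simp_all only: lessThan_iff)
  \<comment> \<open>Pairs of a part and one of its pieces; there are \<open>r\<close> of them, and
    \<open>h\<close> numbers them as colors.\<close>
  define P where "P = Sigma {..<length ns} (\<lambda>i. {..<a i})"
  have "finite P" "card P = r" unfolding P_def r[symmetric] by simp_all
  then obtain h where h: "bij_betw h {..<r} P"
    using ex_bij_betw_nat_finite[of P] atLeast0LessThan by auto
  define C where "C c = case_prod D (h c)" for c
  have hP: "h c \<in> P" if "c < r" for c using h that by (auto dest: bij_betwE)
  have inX: "case_prod D z \<subseteq> X (fst z)" "fst z < length ns" if "z \<in> P" for z
    using that D(2)[of "fst z"] unfolding P_def by (auto; blast)+
  have disjP: "case_prod D x \<inter> case_prod D y = {}" if "x \<in> P" "y \<in> P" "x \<noteq> y" for x y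
  proof (cases "fst x = fst y")
    case True
    then show ?thesis
      using that D(1)[of "fst x"] unfolding P_def disjoint_family_on_def
      by (auto simp: prod_eq_iff; blast)
  next
    case False
    then show ?thesis
      using inX[OF that(1)] inX[OF that(2)] X(2) unfolding disjoint_family_on_def by blast
  qed
  have disj: "disjoint_family_on C {..<r}"
    unfolding disjoint_family_on_def C_def
    using disjP hP bij_betw_imp_inj_on[OF h] by (metis inj_onD lessThan_iff)
  have "(\<Union>c<r. C c) = (\<Union>x \<in> h ` {..<r}. case_prod D x)" unfolding C_def by simp
  also have "\<dots> = (\<Union>x \<in> P. case_prod D x)" using h by (simp add: bij_betw_def)
  also have "\<dots> = (\<Union>i<length ns. \<Union>c<a i. D i c)" unfolding P_def by auto
  also have "\<dots> = verts G" using D(2) X(3) by simp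
  finally have un: "(\<Union>c<r. C c) = verts G" .
  have sizes: "card (C c) \<in> {s, Suc s}" if "c < r" for c
    using hP[OF that] D(3)[of "fst (h c)" "snd (h c)"] unfolding C_def P_def
    by (auto simp: case_prod_beta)
  have fin: "finite (C c)" if "c < r" for c
    using un finite_verts that by (blast intro: finite_subset)
  have "card (verts G) = (\<Sum>c<r. card (C c))"
    unfolding un[symmetric] using fin disj
    by (intro card_UN_disjoint) (auto simp: disjoint_family_on_def)
  then have eq: "int (card (C c)) \<in> {\<lfloor>real (card (verts G)) / real r\<rfloor>, \<lceil>real (card (verts G)) / real r\<rceil>}"
    if "c < r" for c
    using equitable_sizes[of r "\<lambda>c. card (C c)" s c] sizes that by simp
  have "independent_vertices G (C c)" if c: "c < r" for c
  proof -
    obtain i where i: "i < length ns" "C c \<subseteq> X i"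
      using inX[OF hP[OF c]] unfolding C_def by blast
    have "j = i" if "j < length ns" "u \<in> X i" "u \<in> X j" for j u
      using disjoint_family_onD[OF X(2), of j i] i(1) that by blast
    then have "(u, v) \<notin> arcs_ends G" if "u \<in> X i" "v \<in> X i" for u v
      using that unfolding X(4) by blast
    then show ?thesis
      using i X(3) unfolding independent_vertices_def by blast
  qed
  then show ?thesis
    unfolding equitably_colorable_def using disj un eq by (intro exI[of _ C]) blast
qed

section \<open>The interval of color numbers and the threshold\<close>

text \<open>Color numbers from \<open>ceil_sum ns e\<close> to \<open>q\<close>, where
  \<open>e\<close> is \<open>N / q\<close> rounded up, are reached with the size
  \<open>N div q\<close> of the given coloring, lower ones with sizes from \<open>e\<close> to below
  \<open>d\<close>.\<close>

lemma equitably_colorable_interval: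
  assumes len: "length ns \<ge> 2" and pos: "\<forall>i < length ns. ns ! i \<ge> 1"
    and G: "complete_multipartite_graph ns G" and q: "equitably_colorable G q"
  shows "p_value q ns \<le> r \<Longrightarrow> r \<le> q \<Longrightarrow> equitably_colorable G r"
    and "(\<And>r. p \<le> r \<Longrightarrow> r \<le> q \<Longrightarrow> equitably_colorable G r) \<Longrightarrow> p_value q ns \<le> p"
proof -
  have ne: "ns \<noteq> []" using len by auto
  define N where "N = sum_list ns"
  define s where "s = N div q"
  have spl: "splittable ns s q"
    using splittable_of_equitably_colorable[OF G ne q] by (simp add: s_def N_def)
  have "ns ! 0 \<le> N" unfolding N_def using len by (intro elem_le_sum_list) auto
  then have N: "N > 0" using pos[rule_format, of 0] len by linarith
  have "N \<le> q * Suc s" using sum_list_le_of_splittable[OF spl] by (simp only: N_def)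
  then have qpos: "q > 0" using N by (intro gr0I) simp
  define e where "e = nat \<lceil>real N / real q\<rceil>"
  have e_pos: "e > 0" using N qpos by (simp add: e_def)
  define d where "d = obstruction_size q ns"
  have d_eq: "d = (LEAST d. e \<le> d \<and> obstructing ns d)"
    unfolding d_def obstruction_size_def e_def N_def by (simp add: nat_le_iff)
  have "\<exists>d. e \<le> d \<and> obstructing ns d"
    using obstruction_size_exists[OF ne, of q] unfolding e_def N_def by (auto simp: nat_le_iff)
  then have d: "e \<le> d" "obstructing ns d"
    unfolding d_eq by (metis (mono_tags, lifting) LeastI)+
  have min: "\<not> obstructing ns t" if "e \<le> t" "t < d" for t
    using not_less_Least that unfolding d_eq by blast
  have p: "p_value q ns = ceil_sum ns d"
    unfolding p_value_def ceil_sum_def d_def by simp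
  \<comment> \<open>Bridges the given coloring and the first candidate for \<open>d\<close>:
    \<open>e\<close> is \<open>s\<close> if \<open>q\<close> divides \<open>N\<close>, and
    \<open>Suc s\<close> otherwise.\<close>
  have upper: "ceil_sum ns e \<le> q \<and> (\<forall>r. ceil_sum ns e \<le> r \<and> r \<le> q \<longrightarrow> splittable ns s r)"
  proof (cases "q dvd N")
    case True
    then have N_eq: "N = q * s" by (simp add: s_def)
    then have es: "e = s" using qpos by (simp add: e_def)
    then have "q \<le> floor_sum ns s" using splittable_imp(2)[OF spl] e_pos by simp
    moreover have "floor_sum ns s * s \<le> N"
      unfolding floor_sum_def N_def sum_list_sum_nth atLeast0LessThan sum_distrib_right
      by (intro sum_mono) simp
    ultimately have fl: "floor_sum ns s = q"
      using N_eq e_pos es by (simp add: mult.commute)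
    \<comment> \<open>Rounding down loses nothing in total, hence nothing in any entry. So
      \<open>ceil_sum ns s = q\<close>, and only \<open>r = q\<close> remains.\<close>
    have "ns ! i div s * s = ns ! i" if "i < length ns" for i
    proof (rule ccontr)
      assume "ns ! i div s * s \<noteq> ns ! i"
      then have "floor_sum ns s * s < N"
        unfolding floor_sum_def N_def sum_list_sum_nth atLeast0LessThan sum_distrib_right
        using that by (intro sum_strict_mono_ex1) (auto intro!: bexI[of _ i] le_neq_implies_less)
      then show False using fl N_eq by simp
    qed
    then have "{i. i < length ns \<and> \<not> s dvd ns ! i} = {}"
      by (metis (mono_tags, lifting) dvd_triv_right empty_Collect_eq)
    then have "ceil_sum ns s = floor_sum ns s"
      using ceil_sum_eq_floor_sum[of s ns] es e_pos by (simp only: card.empty)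
    then show ?thesis using fl es spl by auto
  next
    case False
    then have es: "e = Suc s"
      unfolding e_def using nat_ceiling_divide_eq_div[OF qpos, of N] by (simp add: s_def)
    obtain a where a: "\<forall>i < length ns. a i * s \<le> ns ! i \<and> ns ! i \<le> a i * Suc s"
      "(\<Sum>i < length ns. a i) = q"
      using spl unfolding splittable_def by blast
    \<comment> \<open>As \<open>s\<close> may be 0 here, division by \<open>s\<close> gives no upper
      bounds; the given splitting \<open>a\<close> provides them.\<close>
    have ca: "nat \<lceil>real (ns ! i) / real (Suc s)\<rceil> \<le> a i" if "i < length ns" for i
      using a that by (subst nat_ceiling_divide_le_iff) auto
    have "ceil_sum ns (Suc s) \<le> q"
      by (rule ceil_sum_le_of_splittable[OF spl])
    moreover have "splittable ns s r" if r: "ceil_sum ns (Suc s) \<le> r" "r \<le> q" for r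
    proof -
      obtain b where b: "\<forall>i\<in>{..<length ns}. nat \<lceil>real (ns ! i) / real (Suc s)\<rceil> \<le> b i \<and> b i \<le> a i"
        "sum b {..<length ns} = r"
        using sum_intermediate_value[of "{..<length ns}"
            "\<lambda>i. nat \<lceil>real (ns ! i) / real (Suc s)\<rceil>" a r] ca r a(2)
        unfolding ceil_sum_def by auto
      have "b i * s \<le> ns ! i \<and> ns ! i \<le> b i * Suc s" if "i < length ns" for i
        using a b(1) that nat_ceiling_divide_le_iff[of "Suc s" "ns ! i" "b i"]
        by (auto intro: order_trans[OF mult_le_mono1])
      then show ?thesis unfolding splittable_def using b(2) by blast
    qed
    ultimately show ?thesis unfolding es by blast
  qed
  show "equitably_colorable G r" if "p_value q ns \<le> r" "r \<le> q"
  proof (cases "r < ceil_sum ns e")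
    case True
    then show ?thesis
      using non_obstructing_cover[OF e_pos d(1) min] that p equitably_colorable_of_splittable[OF G]
      by auto
  next
    case False
    then show ?thesis using upper that(2) equitably_colorable_of_splittable[OF G] by (meson not_less)
  qed
  show "p_value q ns \<le> p" if col: "\<And>r. p \<le> r \<Longrightarrow> r \<le> q \<Longrightarrow> equitably_colorable G r"
  proof (rule ccontr)
    assume "\<not> p_value q ns \<le> p"
    \<comment> \<open>One below the claimed minimum: this number lies between \<open>p\<close> and
      \<open>q\<close>, so it would be colorable.\<close>
    then obtain r where r: "Suc r = ceil_sum ns d" "p \<le> r"
      unfolding p by (cases "ceil_sum ns d") auto
    have "ceil_sum ns d \<le> q"
      using ceil_sum_antimono[OF e_pos d(1), of ns] upper by linarith
    then have "equitably_colorable G r" using col r by simp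
    then show False
      using splittable_of_equitably_colorable(1)[OF G ne]
        not_splittable_below_obstruction[OF len pos less_le_trans[OF e_pos d(1)] d(2) r(1)] by blast
  qed
qed

theorem theorem1:
  fixes G :: "('a, 'b) pre_digraph" and ns :: "nat list"
  assumes "length ns \<ge> 2"
    and "\<And>i. i < length ns \<Longrightarrow> ns ! i \<ge> 1"
    and "complete_multipartite_graph ns G"
  shows "(\<forall>q. equitably_colorable G q \<longrightarrow>
            (\<forall>r. p_value q ns \<le> r \<and> r \<le> q \<longrightarrow> equitably_colorable G r) \<and>
            (\<forall>p. (\<forall>r. p \<le> r \<and> r \<le> q \<longrightarrow> equitably_colorable G r) \<longrightarrow> p_value q ns \<le> p))
       \<and> equitable_chromatic_threshold G = p_value (sum_list ns) ns"
proof -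
  have "\<forall>i < length ns. ns ! i \<ge> 1" using assms(2) by blast
  note interval = equitably_colorable_interval[OF assms(1) this assms(3)]
  have large: "equitably_colorable G q" if q: "sum_list ns \<le> q" for q
  proof (rule equitably_colorable_of_splittable[OF assms(3), of 0])
    \<comment> \<open>Size 0 means classes of at most one vertex; the \<open>q - sum_list ns\<close>
      surplus classes are charged to part 0.\<close>
    define a where "a i = ns ! i + (if i = 0 then q - sum_list ns else 0)" for i
    have "(\<Sum>i<length ns. a i) = q"
      using q assms(1)
      by (auto simp: a_def sum.distrib sum.delta sum_list_sum_nth atLeast0LessThan)
    moreover have "\<forall>i < length ns. a i * 0 \<le> ns ! i \<and> ns ! i \<le> a i * Suc 0" by (simp add: a_def)
    ultimately show "splittable ns 0 q" unfolding splittable_def by blast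
  qed
  have "equitable_chromatic_threshold G = p_value (sum_list ns) ns"
    unfolding equitable_chromatic_threshold_def
  proof (rule Least_equality)
    show "\<forall>q \<ge> p_value (sum_list ns) ns. equitably_colorable G q"
      using interval(1)[OF large[OF order_refl]] large by (metis nle_le)
    show "p_value (sum_list ns) ns \<le> p" if "\<forall>q \<ge> p. equitably_colorable G q" for p
      using interval(2)[OF large[OF order_refl]] that by blast
  qed
  then show ?thesis using interval by blast
qed

end
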